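(* For each GLD-lattice $A$, there exist a GL-algebra $B$ and a monomorphism $\eta:A\to B|_{\mathcal{D}}$ of modal distributive lattices.
   Context: A modal distributive lattice is an algebra $\langle A;\sqcup,\sqcap,\Diamond,\Box,0,1\rangle$ such that $\langle A;\sqcup,\sqcap,0,1\rangle$ is a bounded distributive lattice (with order $\leq$) and $\Box,\Diamond$ are unary operators on $A$ with $\Box 1=1$, $\Diamond 0=0$, and, for all $x,y\in A$, $\Box(x\sqcup y)\leq\Box x\sqcup\Diamond y$ and $\Box x\sqcap\Diamond y\leq\Diamond(x\sqcap y)$. A homomorphism of modal distributive lattices is a homomorphism of bounded lattices commuting with $\Box$ and $\Diamond$; it is a monomorphism if it is injective. A GLD-lattice is a modal distributive lattice $A$ such that: (1) $\Diamond 0=0$ and $\Box 1=1$; (2) $\Diamond(x\sqcup y)=\Diamond x\sqcup\Diamond y$ and $\Box(x\sqcap y)=\Box x\sqcap\Box y$ for all $x,y\in A$; (3) $\Diamond\Diamond x\leq\Diamond x$ and $\Box x\leq\Box\Box x$ for all $x\in A$; (4) for every $x\in A$, $\bigsqcup_{n\in\omega}(x\sqcap\Box^n 0)=x$ and $\inf_{n\in\omega}(x\sqcup\Diamond^n 1)=x$ (i.e. $x$ is the least upper bound, respectively the greatest lower bound, of the indicated set in $A$). Here $\Box^n,\Diamond^n$ denote $n$-fold iteration, with the $0$-fold iterate the identity. A modal algebra is an algebra $\langle B;\sqcup,\sqcap,-,\Box,0,1\rangle$ whose reduct without $\Box$ is a Boolean algebra, $\Box$ being a unary operator; $\Diamond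 x$ abbreviates $-\Box -x$ and $x\rightarrow y$ abbreviates $-x\sqcup y$. A GL-algebra is a modal algebra satisfying $\Box 1=1$, $\Box(x\sqcap y)=\Box x\sqcap\Box y$, and $\Box(\Box x\rightarrow x)\leq\Box x$ for all $x,y$. $B|_{\mathcal{D}}$ denotes the modal distributive lattice reduct $\langle B;\sqcup,\sqcap,\Diamond,\Box,0,1\rangle$ of $B$. *)

theory Defs
  imports "HOL-Algebra.Lattice"
begin

(* Algebras are carrier-based, built on the lattices of HOL-Algebra: join, meet, bottom and top
   are determined by the order, and the order record is extended by the remaining operations. *)

record 'a box_order = "'a gorder" +
  box :: "'a \<Rightarrow> 'a"  (\<open>\<box>\<index>_\<close> [80] 80)

record 'a modal_dlat = "'a box_order" +
  dia :: "'a \<Rightarrow> 'a"  (\<open>\<diamond>\<index>_\<close> [80] 80)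

record 'a modal_balg = "'a box_order" +
  neg :: "'a \<Rightarrow> 'a"  (\<open>\<sim>\<index>_\<close> [80] 80)

locale bounded_distributive_lattice = Lattice.bounded_lattice L for L (structure) +
  assumes meet_join_distrib:
    "\<lbrakk>x \<in> carrier L; y \<in> carrier L; z \<in> carrier L\<rbrakk>
      \<Longrightarrow> x \<sqinter> (y \<squnion> z) = (x \<sqinter> y) \<squnion> (x \<sqinter> z)"

locale modal_distributive_lattice = bounded_distributive_lattice A for A (structure) +
  assumes box_closed: "x \<in> carrier A \<Longrightarrow> \<box>x \<in> carrier A"
    and dia_closed: "x \<in> carrier A \<Longrightarrow> \<diamond>x \<in> carrier A"
    and box_top: "\<box>\<top> = \<top>"
    and dia_bottom: "\<diamond>\<bottom> = \<bottom>"
    and box_join_le: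
      "\<lbrakk>x \<in> carrier A; y \<in> carrier A\<rbrakk> \<Longrightarrow> \<box>(x \<squnion> y) \<sqsubseteq> \<box>x \<squnion> \<diamond>y"
    and meet_dia_le:
      "\<lbrakk>x \<in> carrier A; y \<in> carrier A\<rbrakk> \<Longrightarrow> \<box>x \<sqinter> \<diamond>y \<sqsubseteq> \<diamond>(x \<sqinter> y)"

locale gld_lattice = modal_distributive_lattice A for A (structure) +
  assumes dia_join:
      "\<lbrakk>x \<in> carrier A; y \<in> carrier A\<rbrakk> \<Longrightarrow> \<diamond>(x \<squnion> y) = \<diamond>x \<squnion> \<diamond>y"
    and box_meet:
      "\<lbrakk>x \<in> carrier A; y \<in> carrier A\<rbrakk> \<Longrightarrow> \<box>(x \<sqinter> y) = \<box>x \<sqinter> \<box>y"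
    and dia_dia_le: "x \<in> carrier A \<Longrightarrow> \<diamond>\<diamond>x \<sqsubseteq> \<diamond>x"
    and box_le_box_box: "x \<in> carrier A \<Longrightarrow> \<box>x \<sqsubseteq> \<box>\<box>x"
    and box_iterates_lub:
      "x \<in> carrier A \<Longrightarrow> least A x (Upper A {x \<sqinter> (box A ^^ n) \<bottom> |n. True})"
    and dia_iterates_glb:
      "x \<in> carrier A \<Longrightarrow> greatest A x (Lower A {x \<squnion> (dia A ^^ n) \<top> |n. True})"

locale modal_homomorphism =
  A: modal_distributive_lattice A + A': modal_distributive_lattice A'
  for A (structure) and A' (structure) +
  fixes h
  assumes hom_closed: "x \<in> carrier A \<Longrightarrow> h x \<in> carrier A'"
    and hom_join:
      "\<lbrakk>x \<in> carrier A; y \<in> carrier A\<rbrakk> \<Longrightarrow> h (x \<squnion>\<^bsub>A\<^esub> y) = h x \<squnion>\<^bsub>A'\<^esub> h y"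
    and hom_meet:
      "\<lbrakk>x \<in> carrier A; y \<in> carrier A\<rbrakk> \<Longrightarrow> h (x \<sqinter>\<^bsub>A\<^esub> y) = h x \<sqinter>\<^bsub>A'\<^esub> h y"
    and hom_bottom: "h \<bottom>\<^bsub>A\<^esub> = \<bottom>\<^bsub>A'\<^esub>"
    and hom_top: "h \<top>\<^bsub>A\<^esub> = \<top>\<^bsub>A'\<^esub>"
    and hom_box: "x \<in> carrier A \<Longrightarrow> h (\<box>\<^bsub>A\<^esub>x) = \<box>\<^bsub>A'\<^esub>(h x)"
    and hom_dia: "x \<in> carrier A \<Longrightarrow> h (\<diamond>\<^bsub>A\<^esub>x) = \<diamond>\<^bsub>A'\<^esub>(h x)"

locale modal_monomorphism = modal_homomorphism +
  assumes hom_inj: "inj_on h (carrier A)"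

locale modal_algebra = bounded_distributive_lattice B for B (structure) +
  assumes neg_closed: "x \<in> carrier B \<Longrightarrow> \<sim>x \<in> carrier B"
    and meet_neg: "x \<in> carrier B \<Longrightarrow> x \<sqinter> \<sim>x = \<bottom>"
    and join_neg: "x \<in> carrier B \<Longrightarrow> x \<squnion> \<sim>x = \<top>"
    and box_closed: "x \<in> carrier B \<Longrightarrow> \<box>x \<in> carrier B"

locale gl_algebra = modal_algebra B for B (structure) +
  assumes box_top: "\<box>\<top> = \<top>"
    and box_meet:
      "\<lbrakk>x \<in> carrier B; y \<in> carrier B\<rbrakk> \<Longrightarrow> \<box>(x \<sqinter> y) = \<box>x \<sqinter> \<box>y"
    and loeb: "x \<in> carrier B \<Longrightarrow> \<box>(\<sim>\<box>x \<squnion> x) \<sqsubseteq> \<box>x"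

definition lattice_reduct :: "('a, 'm) modal_balg_scheme \<Rightarrow> 'a modal_dlat" where
  "lattice_reduct B =
    \<lparr>carrier = carrier B, eq = eq B, le = le B, box = box B,
     dia = (\<lambda>x. \<sim>\<^bsub>B\<^esub>\<box>\<^bsub>B\<^esub>\<sim>\<^bsub>B\<^esub>x)\<rparr>"

(* Existence of a GL-algebra can only be asserted over one fixed element type. The type
   'a set set suffices for A over 'a: it contains the powerset of every set of
   prime filters of A. *)

end

theory Submission
  imports Defs
begin

text \<open>
  The proof represents \<open>A\<close> by sets of prime filters, as in Stone's representation theorem, with an
  accessibility relation interpreting the modalities. Put \<open>P R Q\<close> if \<open>\<box>x \<in> P\<close> implies \<open>x \<in> Q\<close>, and
  \<open>x \<in> Q\<close> implies \<open>\<diamond>x \<in> P\<close>. In a Boolean algebra either half would imply the other; without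
  negation both are imposed. The two interaction laws between \<open>\<box>\<close> and \<open>\<diamond>\<close> provide enough
  \<open>R\<close>-successors: \<open>\<box>a \<notin> P\<close> is refuted by a successor omitting \<open>a\<close> (\<open>box_witness\<close>), and \<open>\<diamond>a \<in> P\<close> is
  realised by a successor containing \<open>a\<close> (\<open>dia_witness\<close>).

  The relation \<open>R\<close> is transitive because \<open>\<box>x \<sqsubseteq> \<box>\<box>x\<close> and \<open>\<diamond>\<diamond>x \<sqsubseteq> \<diamond>x\<close>, but its converse need not be
  well-founded on all prime filters. Therefore only those prime filters are kept that contain
  \<open>\<box>\<^sup>n\<bottom>\<close> for some \<open>n\<close>. If \<open>\<box>\<^sup>n\<^sup>+\<^sup>1\<bottom> \<in> P\<close> and \<open>P R Q\<close> then \<open>\<box>\<^sup>n\<bottom> \<in> Q\<close>, so every \<open>R\<close>-successor of a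
  kept filter is kept and the least such \<open>n\<close> drops along \<open>R\<close> (\<open>successor_height\<close>). Closure under
  successors means that the restriction does not disturb the interpretation of the modalities; the
  drop means that the restricted frame is conversely well-founded, so that its powerset is a
  GL-algebra (\<open>gl_algebra_complex_algebra\<close>).

  What remains is that enough points survive for \<open>a \<mapsto> {P. a \<in> P}\<close> to be injective, and this is
  what the axiom \<open>box_iterates_lub\<close> is for: if \<open>a\<close> is not below \<open>b\<close>, then, \<open>a\<close> being the join of
  the elements \<open>a \<sqinter> \<box>\<^sup>n\<bottom>\<close>, one of these is not below \<open>b\<close> either, and a prime filter that contains
  it and omits \<open>b\<close> contains \<open>\<box>\<^sup>n\<bottom>\<close> (\<open>stone_map_le_imp_le\<close>).
\<close>

section \<open>Complex algebras of frames\<close>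

text \<open>
  Join, meet and bounds depend only on the carrier and the order. Stating this for every record
  over the powerset order covers both the complex algebra of a frame and its lattice reduct, which
  are records of different types.
\<close>

lemma
  fixes L (structure)
  assumes carrier: "carrier L = Pow X" and eq: "eq L = (=)" and le: "le L = (\<subseteq>)"
  shows bounded_distributive_lattice_Pow: "bounded_distributive_lattice L"
    and join_Pow: "\<And>S T. \<lbrakk>S \<subseteq> X; T \<subseteq> X\<rbrakk> \<Longrightarrow> S \<squnion> T = S \<union> T"
    and meet_Pow: "\<And>S T. \<lbrakk>S \<subseteq> X; T \<subseteq> X\<rbrakk> \<Longrightarrow> S \<sqinter> T = S \<inter> T"
    and top_Pow: "\<top> = X"
    and bottom_Pow: "\<bottom> = {}"
proof -
  have lub: "least L (S \<union> T) (Upper L {S, T})" if "S \<subseteq> X" "T \<subseteq> X" for S T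
    using that carrier le by (auto simp: least_def Upper_def)
  have glb: "greatest L (S \<inter> T) (Lower L {S, T})" if "S \<subseteq> X" "T \<subseteq> X" for S T
    using that carrier le by (auto simp: greatest_def Lower_def)
  have bot: "least L {} (carrier L)" and top: "greatest L X (carrier L)"
    using carrier le by (auto simp: least_def greatest_def)
  interpret Lattice.bounded_lattice L
    by unfold_locales (use carrier eq le bot top in \<open>auto intro: lub glb\<close>)
  show join: "S \<squnion> T = S \<union> T" if "S \<subseteq> X" "T \<subseteq> X" for S T
    using least_unique[OF sup_of_two_least lub] that carrier by (simp add: join_def)
  show meet: "S \<sqinter> T = S \<inter> T" if "S \<subseteq> X" "T \<subseteq> X" for S T
    using greatest_unique[OF inf_of_two_greatest glb] that carrier by (simp add: meet_def)
  show "\<top> = X" "\<bottom> = {}"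
    using greatest_unique[OF top_greatest top] least_unique[OF bottom_least bot] by simp_all
  show "bounded_distributive_lattice L"
  proof
    show "x \<sqinter> (y \<squnion> z) = x \<sqinter> y \<squnion> x \<sqinter> z"
      if "x \<in> carrier L" "y \<in> carrier L" "z \<in> carrier L" for x y z
    proof -
      have *: "x \<subseteq> X" "y \<subseteq> X" "z \<subseteq> X" "y \<union> z \<subseteq> X" "x \<inter> y \<subseteq> X" "x \<inter> z \<subseteq> X"
        using that carrier by auto
      show ?thesis
        by (simp add: join meet * Int_Un_distrib)
    qed
  qed
qed

definition complex_algebra :: "'w set \<Rightarrow> ('w \<times> 'w) set \<Rightarrow> 'w set modal_balg" where
  "complex_algebra X R =
    \<lparr>carrier = Pow X, eq = (=), le = (\<subseteq>),
     box = (\<lambda>S. {x \<in> X. R `` {x} \<subseteq> S}), neg = (\<lambda>S. X - S)\<rparr>"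

lemma complex_algebra_simps [simp]:
  "carrier (complex_algebra X R) = Pow X"
  "eq (complex_algebra X R) = (=)"
  "le (complex_algebra X R) = (\<subseteq>)"
  "box (complex_algebra X R) S = {x \<in> X. R `` {x} \<subseteq> S}"
  "neg (complex_algebra X R) S = X - S"
  by (simp_all add: complex_algebra_def)

lemmas complex_algebra_lattice [simp] =
  join_Pow[where L = "complex_algebra X R" and X = X, simplified]
  meet_Pow[where L = "complex_algebra X R" and X = X, simplified]
  top_Pow[where L = "complex_algebra X R" and X = X, simplified]
  bottom_Pow[where L = "complex_algebra X R" and X = X, simplified]
  for X R

lemma reduct_simps [simp]:
  "carrier (lattice_reduct (complex_algebra X R)) = Pow X"
  "eq (lattice_reduct (complex_algebra X R)) = (=)"
  "le (lattice_reduct (complex_algebra X R)) = (\<subseteq>)"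
  "box (lattice_reduct (complex_algebra X R)) S = {x \<in> X. R `` {x} \<subseteq> S}"
  by (simp_all add: lattice_reduct_def)

text \<open>
  As \<open>R\<close> does not leave \<open>X\<close>, complementing relative to \<open>X\<close> on both sides of the box turns
  \<^emph>\<open>all successors\<close> into \<^emph>\<open>some successor\<close>.
\<close>

lemma dia_reduct:
  assumes "R \<subseteq> X \<times> X"
  shows "dia (lattice_reduct (complex_algebra X R)) S = {x \<in> X. R `` {x} \<inter> S \<noteq> {}}"
  using assms by (auto simp: lattice_reduct_def)

lemmas reduct_lattice [simp] =
  join_Pow[where L = "lattice_reduct (complex_algebra X R)" and X = X, simplified]
  meet_Pow[where L = "lattice_reduct (complex_algebra X R)" and X = X, simplified]
  top_Pow[where L = "lattice_reduct (complex_algebra X R)" and X = X, simplified]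
  bottom_Pow[where L = "lattice_reduct (complex_algebra X R)" and X = X, simplified]
  for X R

lemma modal_distributive_lattice_reduct:
  assumes "R \<subseteq> X \<times> X"
  shows "modal_distributive_lattice (lattice_reduct (complex_algebra X R))"
proof -
  interpret bounded_distributive_lattice "lattice_reduct (complex_algebra X R)"
    by (rule bounded_distributive_lattice_Pow) simp_all
  show ?thesis
  proof (unfold_locales, goal_cases)
    case (5 S T)
    have "{x \<in> X. R `` {x} \<subseteq> S} \<subseteq> X" "{x \<in> X. R `` {x} \<inter> T \<noteq> {}} \<subseteq> X" for S T by auto
    then show ?case using 5 by (auto simp: dia_reduct[OF assms])
  next
    case (6 S T)
    have "{x \<in> X. R `` {x} \<subseteq> S} \<subseteq> X" "{x \<in> X. R `` {x} \<inter> T \<noteq> {}} \<subseteq> X" for S T by auto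
    then show ?case using 6 by (auto simp: dia_reduct[OF assms])
  qed (use assms in \<open>auto simp: dia_reduct[OF assms]\<close>)
qed

text \<open>
  Loeb's law is induction along the converse of \<open>R\<close>. Suppose that every successor of \<open>x\<close> lies in
  \<open>S\<close> as soon as all its own successors do. By transitivity the successors of a successor \<open>y\<close> of
  \<open>x\<close> are again successors of \<open>x\<close>, so they lie in \<open>S\<close> by induction, hence so does \<open>y\<close>.
\<close>

lemma gl_algebra_complex_algebra:
  assumes R: "R \<subseteq> X \<times> X" and "trans R" and "wf (R\<inverse>)"
  shows "gl_algebra (complex_algebra X R)"
proof -
  interpret bounded_distributive_lattice "complex_algebra X R"
    by (rule bounded_distributive_lattice_Pow) simp_all
  have loeb: "y \<in> S"
    if S: "S \<subseteq> X" and x: "R `` {x} \<subseteq> (X - {x \<in> X. R `` {x} \<subseteq> S}) \<union> S" and "(x, y) \<in> R" for S x y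
    using \<open>wf (R\<inverse>)\<close> \<open>(x, y) \<in> R\<close>
  proof (induction y rule: wf_induct_rule)
    case (less y)
    then have "R `` {y} \<subseteq> S"
      using \<open>trans R\<close> by (auto dest: transD)
    with less.prems x R show "y \<in> S" by blast
  qed
  show ?thesis
  proof (unfold_locales, goal_cases)
    case (6 S T)
    have "{x \<in> X. R `` {x} \<subseteq> S} \<subseteq> X" for S by auto
    then show ?case using 6 by auto
  next
    case (7 S)
    then have S: "S \<subseteq> X" "X - {x \<in> X. R `` {x} \<subseteq> S} \<subseteq> X" by auto
    then show ?case using loeb[of S] by auto
  qed (use R in auto)
qed

section \<open>Prime filters of a distributive lattice\<close>

definition lattice_filter :: "('a, 'm) gorder_scheme \<Rightarrow> 'a set \<Rightarrow> bool" where
  "lattice_filter L F \<longleftrightarrow> F \<subseteq> carrier L \<and> \<top>\<^bsub>L\<^esub> \<in> F \<and>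
    (\<forall>x\<in>F. \<forall>y\<in>F. x \<sqinter>\<^bsub>L\<^esub> y \<in> F) \<and> (\<forall>x\<in>F. \<forall>y\<in>carrier L. x \<sqsubseteq>\<^bsub>L\<^esub> y \<longrightarrow> y \<in> F)"

definition lattice_ideal :: "('a, 'm) gorder_scheme \<Rightarrow> 'a set \<Rightarrow> bool" where
  "lattice_ideal L I \<longleftrightarrow> I \<subseteq> carrier L \<and> \<bottom>\<^bsub>L\<^esub> \<in> I \<and>
    (\<forall>x\<in>I. \<forall>y\<in>I. x \<squnion>\<^bsub>L\<^esub> y \<in> I) \<and> (\<forall>x\<in>I. \<forall>y\<in>carrier L. y \<sqsubseteq>\<^bsub>L\<^esub> x \<longrightarrow> y \<in> I)"

definition prime_filter :: "('a, 'm) gorder_scheme \<Rightarrow> 'a set \<Rightarrow> bool" where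
  "prime_filter L P \<longleftrightarrow> lattice_filter L P \<and> \<bottom>\<^bsub>L\<^esub> \<notin> P \<and>
    (\<forall>x\<in>carrier L. \<forall>y\<in>carrier L. x \<squnion>\<^bsub>L\<^esub> y \<in> P \<longrightarrow> x \<in> P \<or> y \<in> P)"

context bounded_distributive_lattice
begin

text \<open>
  Applied backwards without bound, antisymmetry and the congruence rules of \<open>\<sqsubseteq>\<close> make the classical
  reasoner diverge on inequalities.
\<close>

declare le_cong_l [rule del] le_cong_r [rule del] weak_refl [rule del]
  weak_le_antisym [rule del] le_antisym [rule del]

lemma meet_mono:
  assumes "x \<sqsubseteq> x'" "y \<sqsubseteq> y'"
    and "x \<in> carrier L" "y \<in> carrier L" "x' \<in> carrier L" "y' \<in> carrier L"
  shows "x \<sqinter> y \<sqsubseteq> x' \<sqinter> y'"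
proof (rule meet_le)
  show "x \<sqinter> y \<sqsubseteq> x'" using le_trans[OF meet_left[of x y] assms(1)] assms by simp
  show "x \<sqinter> y \<sqsubseteq> y'" using le_trans[OF meet_right[of x y] assms(2)] assms by simp
qed (use assms in simp_all)

lemma join_mono:
  assumes "x \<sqsubseteq> x'" "y \<sqsubseteq> y'"
    and "x \<in> carrier L" "y \<in> carrier L" "x' \<in> carrier L" "y' \<in> carrier L"
  shows "x \<squnion> y \<sqsubseteq> x' \<squnion> y'"
proof (rule join_le)
  show "x \<sqsubseteq> x' \<squnion> y'" using le_trans[OF assms(1) join_left[of x' y']] assms by simp
  show "y \<sqsubseteq> x' \<squnion> y'" using le_trans[OF assms(2) join_right[of x' y']] assms by simp
qed (use assms in simp_all)

lemma join_eq_right: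
  assumes "x \<sqsubseteq> y" "x \<in> carrier L" "y \<in> carrier L"
  shows "x \<squnion> y = y"
  by (rule le_antisym) (use assms join_le[of x y y] join_right[of x y] in simp_all)

lemma meet_eq_left:
  assumes "x \<sqsubseteq> y" "x \<in> carrier L" "y \<in> carrier L"
  shows "x \<sqinter> y = x"
  by (rule le_antisym) (use assms meet_le[of x x y] meet_left[of x y] in simp_all)

lemma filter_subset: "lattice_filter L F \<Longrightarrow> F \<subseteq> carrier L"
  and filter_top: "lattice_filter L F \<Longrightarrow> \<top> \<in> F"
  and filter_meet: "\<lbrakk>lattice_filter L F; x \<in> F; y \<in> F\<rbrakk> \<Longrightarrow> x \<sqinter> y \<in> F"
  and filter_up: "\<lbrakk>lattice_filter L F; x \<in> F; x \<sqsubseteq> y; y \<in> carrier L\<rbrakk> \<Longrightarrow> y \<in> F"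
  by (auto simp: lattice_filter_def)

lemma ideal_subset: "lattice_ideal L I \<Longrightarrow> I \<subseteq> carrier L"
  and ideal_bottom: "lattice_ideal L I \<Longrightarrow> \<bottom> \<in> I"
  and ideal_join: "\<lbrakk>lattice_ideal L I; x \<in> I; y \<in> I\<rbrakk> \<Longrightarrow> x \<squnion> y \<in> I"
  and ideal_down: "\<lbrakk>lattice_ideal L I; x \<in> I; y \<sqsubseteq> x; y \<in> carrier L\<rbrakk> \<Longrightarrow> y \<in> I"
  by (auto simp: lattice_ideal_def)

lemma prime_filterD:
  assumes "prime_filter L P"
  shows prime_filter_filter: "lattice_filter L P"
    and prime_filter_bottom: "\<bottom> \<notin> P"
    and prime_filter_join: "\<lbrakk>x \<squnion> y \<in> P; x \<in> carrier L; y \<in> carrier L\<rbrakk> \<Longrightarrow> x \<in> P \<or> y \<in> P"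
  using assms by (auto simp: prime_filter_def)

lemma prime_filter_meet_iff:
  assumes P: "prime_filter L P" and "x \<in> carrier L" "y \<in> carrier L"
  shows "x \<sqinter> y \<in> P \<longleftrightarrow> x \<in> P \<and> y \<in> P"
proof -
  note F = prime_filter_filter[OF P]
  show ?thesis
    using filter_meet[OF F, of x y] filter_up[OF F _ meet_left[of x y]]
      filter_up[OF F _ meet_right[of x y]] assms by blast
qed

lemma prime_filter_join_iff:
  assumes P: "prime_filter L P" and "x \<in> carrier L" "y \<in> carrier L"
  shows "x \<squnion> y \<in> P \<longleftrightarrow> x \<in> P \<or> y \<in> P"
proof -
  note F = prime_filter_filter[OF P]
  show ?thesis
    using prime_filter_join[OF P, of x y] filter_up[OF F _ join_left[of x y]]
      filter_up[OF F _ join_right[of x y]] assms by auto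
qed

text \<open>The filter generated by a filter and one further element, and dually for ideals.\<close>

lemma
  assumes F: "lattice_filter L F" and a: "a \<in> carrier L"
  defines "G \<equiv> {z \<in> carrier L. \<exists>m\<in>F. m \<sqinter> a \<sqsubseteq> z}"
  shows filter_adjoin: "lattice_filter L G" and subset_filter_adjoin: "F \<subseteq> G"
    and mem_filter_adjoin: "a \<in> G"
proof -
  note Fc = subsetD[OF filter_subset[OF F]]
  show "F \<subseteq> G"
    using meet_left Fc a unfolding G_def by blast
  then have "\<top> \<in> G" using filter_top[OF F] by blast
  show "a \<in> G"
    using meet_right Fc a filter_top[OF F] unfolding G_def by blast
  have "x \<sqinter> y \<in> G" if xy: "x \<in> G" "y \<in> G" for x y
  proof -
    obtain m n where m: "m \<in> F" "m \<sqinter> a \<sqsubseteq> x" and n: "n \<in> F" "n \<sqinter> a \<sqsubseteq> y"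
      and c: "x \<in> carrier L" "y \<in> carrier L"
      using xy by (auto simp: G_def)
    note mn = Fc[OF m(1)] Fc[OF n(1)]
    have "(m \<sqinter> n) \<sqinter> a \<sqsubseteq> m \<sqinter> a" "(m \<sqinter> n) \<sqinter> a \<sqsubseteq> n \<sqinter> a"
      using mn a by (simp_all add: meet_mono meet_left meet_right)
    then have "(m \<sqinter> n) \<sqinter> a \<sqsubseteq> x" "(m \<sqinter> n) \<sqinter> a \<sqsubseteq> y"
      using m n mn a c by (meson le_trans meet_closed)+
    then have "(m \<sqinter> n) \<sqinter> a \<sqsubseteq> x \<sqinter> y"
      using mn a c by (simp add: meet_le)
    then show ?thesis
      using filter_meet[OF F m(1) n(1)] c by (auto simp: G_def)
  qed
  moreover have "y \<in> G" if "x \<in> G" "y \<in> carrier L" "x \<sqsubseteq> y" for x y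
    using that Fc a unfolding G_def by (blast intro: le_trans meet_closed)
  ultimately show "lattice_filter L G"
    using \<open>\<top> \<in> G\<close> by (auto simp: lattice_filter_def G_def)
qed

lemma
  assumes I: "lattice_ideal L I" and a: "a \<in> carrier L"
  defines "J \<equiv> {z \<in> carrier L. \<exists>m\<in>I. z \<sqsubseteq> a \<squnion> m}"
  shows ideal_adjoin: "lattice_ideal L J" and subset_ideal_adjoin: "I \<subseteq> J"
    and mem_ideal_adjoin: "a \<in> J"
proof -
  note Ic = subsetD[OF ideal_subset[OF I]]
  show "I \<subseteq> J"
    using join_right Ic a unfolding J_def by blast
  then have "\<bottom> \<in> J" using ideal_bottom[OF I] by blast
  show "a \<in> J"
    using join_left Ic a ideal_bottom[OF I] unfolding J_def by blast
  have "x \<squnion> y \<in> J" if xy: "x \<in> J" "y \<in> J" for x y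
  proof -
    obtain m n where m: "m \<in> I" "x \<sqsubseteq> a \<squnion> m" and n: "n \<in> I" "y \<sqsubseteq> a \<squnion> n"
      and c: "x \<in> carrier L" "y \<in> carrier L"
      using xy by (auto simp: J_def)
    note mn = Ic[OF m(1)] Ic[OF n(1)]
    have "a \<squnion> m \<sqsubseteq> a \<squnion> (m \<squnion> n)" "a \<squnion> n \<sqsubseteq> a \<squnion> (m \<squnion> n)"
      using mn a by (simp_all add: join_mono join_left join_right)
    then have "x \<sqsubseteq> a \<squnion> (m \<squnion> n)" "y \<sqsubseteq> a \<squnion> (m \<squnion> n)"
      using m n mn a c by (meson le_trans join_closed)+
    then have "x \<squnion> y \<sqsubseteq> a \<squnion> (m \<squnion> n)"
      using mn a c by (simp add: join_le)
    then show ?thesis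
      using ideal_join[OF I m(1) n(1)] c by (auto simp: J_def)
  qed
  moreover have "y \<in> J" if "x \<in> J" "y \<in> carrier L" "y \<sqsubseteq> x" for x y
    using that Ic a unfolding J_def by (blast intro: le_trans join_closed)
  ultimately show "lattice_ideal L J"
    using \<open>\<bottom> \<in> J\<close> by (auto simp: lattice_ideal_def J_def)
qed

text \<open>
  A filter \<open>P\<close> that is maximal among those extending \<open>F\<close> and disjoint from \<open>I\<close> is prime. Indeed,
  adjoining any \<open>x \<notin> P\<close> makes it meet \<open>I\<close>, which means \<open>m \<sqinter> x \<in> I\<close> for some \<open>m \<in> P\<close>. If \<open>x\<close> and
  \<open>y\<close> are both outside \<open>P\<close>, then for a common such \<open>m\<close> distributivity gives
  \<open>m \<sqinter> (x \<squnion> y) \<in> I\<close>, whereas this element would be in \<open>P\<close> if \<open>x \<squnion> y\<close> were.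
\<close>

theorem prime_filter_separation:
  assumes F: "lattice_filter L F" and I: "lattice_ideal L I" and FI: "F \<inter> I = {}"
  obtains P where "prime_filter L P" "F \<subseteq> P" "P \<inter> I = {}"
proof -
  define \<A> where "\<A> = {G. lattice_filter L G \<and> F \<subseteq> G \<and> G \<inter> I = {}}"
  have "\<exists>M\<in>\<A>. \<forall>G\<in>\<A>. M \<subseteq> G \<longrightarrow> G = M"
  proof (rule subset_Zorn_nonempty)
    show "\<A> \<noteq> {}" using F FI by (auto simp: \<A>_def)
    fix \<C> assume "\<C> \<noteq> {}" and chain: "subset.chain \<A> \<C>"
    then have C: "lattice_filter L G" "F \<subseteq> G" "G \<inter> I = {}" if "G \<in> \<C>" for G
      using that by (auto simp: \<A>_def subset_chain_def)
    have "x \<sqinter> y \<in> \<Union>\<C>" if xy: "x \<in> \<Union>\<C>" "y \<in> \<Union>\<C>" for x y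
    proof -
      obtain G where "G \<in> \<C>" "x \<in> G" "y \<in> G"
        using xy chain unfolding subset_chain_def by blast
      then show ?thesis using filter_meet[OF C(1)] by blast
    qed
    then have "lattice_filter L (\<Union>\<C>)"
      using C \<open>\<C> \<noteq> {}\<close> unfolding lattice_filter_def by blast
    then show "\<Union>\<C> \<in> \<A>"
      using C \<open>\<C> \<noteq> {}\<close> unfolding \<A>_def by blast
  qed
  then obtain P where "P \<in> \<A>" and P_max: "\<And>G. \<lbrakk>G \<in> \<A>; P \<subseteq> G\<rbrakk> \<Longrightarrow> G = P"
    by metis
  then have P: "lattice_filter L P" "F \<subseteq> P" "P \<inter> I = {}"
    by (simp_all add: \<A>_def)
  note Pc = subsetD[OF filter_subset[OF P(1)]]
  have escape: "\<exists>m\<in>P. m \<sqinter> x \<in> I" if x: "x \<in> carrier L" "x \<notin> P" for x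
  proof -
    let ?G = "{z \<in> carrier L. \<exists>m\<in>P. m \<sqinter> x \<sqsubseteq> z}"
    have "?G \<noteq> P" using mem_filter_adjoin[OF P(1) x(1)] x(2) by blast
    moreover have "P \<subseteq> ?G" by (rule subset_filter_adjoin[OF P(1) x(1)])
    ultimately have "?G \<notin> \<A>" using P_max by blast
    then have "?G \<inter> I \<noteq> {}"
      using filter_adjoin[OF P(1) x(1)] P(2) \<open>P \<subseteq> ?G\<close> unfolding \<A>_def by blast
    then obtain z m where z: "z \<in> I" "m \<in> P" "m \<sqinter> x \<sqsubseteq> z" by blast
    then have "m \<sqinter> x \<in> I" using ideal_down[OF I z(1,3)] Pc x(1) by simp
    with z(2) show ?thesis by blast
  qed
  have "x \<in> P \<or> y \<in> P" if xy: "x \<squnion> y \<in> P" "x \<in> carrier L" "y \<in> carrier L" for x y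
  proof (rule ccontr)
    assume "\<not> (x \<in> P \<or> y \<in> P)"
    then obtain m n where m: "m \<in> P" "m \<sqinter> x \<in> I" and n: "n \<in> P" "n \<sqinter> y \<in> I"
      using escape xy by blast
    note mn = Pc[OF m(1)] Pc[OF n(1)]
    have "(m \<sqinter> n) \<sqinter> x \<sqsubseteq> m \<sqinter> x" "(m \<sqinter> n) \<sqinter> y \<sqsubseteq> n \<sqinter> y"
      using mn xy by (simp_all add: meet_mono meet_left meet_right)
    then have "(m \<sqinter> n) \<sqinter> x \<in> I" "(m \<sqinter> n) \<sqinter> y \<in> I"
      using ideal_down[OF I m(2)] ideal_down[OF I n(2)] mn xy by simp_all
    then have "(m \<sqinter> n) \<sqinter> (x \<squnion> y) \<in> I"
      using ideal_join[OF I] mn xy by (simp add: meet_join_distrib)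
    moreover have "(m \<sqinter> n) \<sqinter> (x \<squnion> y) \<in> P"
      by (intro filter_meet[OF P(1)] m(1) n(1) xy(1))
    ultimately show False using P(3) by blast
  qed
  then have "prime_filter L P"
    using P ideal_bottom[OF I] by (auto simp: prime_filter_def)
  with P show thesis using that by blast
qed

lemma prime_filter_not_le:
  assumes "a \<in> carrier L" "b \<in> carrier L" "\<not> a \<sqsubseteq> b"
  obtains P where "prime_filter L P" "a \<in> P" "b \<notin> P"
proof -
  let ?F = "{z \<in> carrier L. a \<sqsubseteq> z}" and ?I = "{z \<in> carrier L. z \<sqsubseteq> b}"
  have "lattice_filter L ?F"
    using assms meet_le le_trans[OF _ _ assms(1)]
    by (auto simp: lattice_filter_def top_higher)
  moreover have "lattice_ideal L ?I"
    using assms join_le le_trans[OF _ _ _ _ assms(2)]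
    by (auto simp: lattice_ideal_def bottom_lower)
  moreover have "?F \<inter> ?I = {}"
    using assms le_trans[OF _ _ assms(1) _ assms(2)] by blast
  ultimately obtain P where "prime_filter L P" "?F \<subseteq> P" "P \<inter> ?I = {}"
    by (rule prime_filter_separation)
  with assms show thesis using that[of P] by auto
qed

end

section \<open>The canonical frame\<close>

context gld_lattice
begin

lemma box_mono:
  assumes "x \<sqsubseteq> y" "x \<in> carrier A" "y \<in> carrier A"
  shows "\<box>x \<sqsubseteq> \<box>y"
  using box_meet[of x y] meet_eq_left[of x y] meet_right[of "\<box>x" "\<box>y"] box_closed assms by simp

lemma dia_mono:
  assumes "x \<sqsubseteq> y" "x \<in> carrier A" "y \<in> carrier A"
  shows "\<diamond>x \<sqsubseteq> \<diamond>y"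
  using dia_join[of x y] join_eq_right[of x y] join_left[of "\<diamond>x" "\<diamond>y"] dia_closed assms by simp

definition canonical_rel :: "'a set \<Rightarrow> 'a set \<Rightarrow> bool" where
  "canonical_rel P Q \<longleftrightarrow> (\<forall>x\<in>carrier A. (\<box>x \<in> P \<longrightarrow> x \<in> Q) \<and> (x \<in> Q \<longrightarrow> \<diamond>x \<in> P))"

lemma canonical_rel_trans:
  assumes P: "prime_filter A P" and PQ: "canonical_rel P Q" and QS: "canonical_rel Q S"
  shows "canonical_rel P S"
  unfolding canonical_rel_def
proof (intro ballI conjI impI)
  fix x assume x: "x \<in> carrier A"
  note up = filter_up[OF prime_filter_filter[OF P]]
  show "x \<in> S" if "\<box>x \<in> P"
  proof -
    have "\<box>\<box>x \<in> P" using up[OF that box_le_box_box[OF x]] x box_closed by simp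
    then have "\<box>x \<in> Q" using PQ x box_closed by (simp add: canonical_rel_def)
    then show ?thesis using QS x by (simp add: canonical_rel_def)
  qed
  show "\<diamond>x \<in> P" if "x \<in> S"
  proof -
    have "\<diamond>x \<in> Q" using that QS x by (simp add: canonical_rel_def)
    then have "\<diamond>\<diamond>x \<in> P" using PQ x dia_closed by (simp add: canonical_rel_def)
    then show ?thesis using up[OF _ dia_dia_le[OF x]] x dia_closed by simp
  qed
qed

lemma box_preimage_filter:
  assumes P: "prime_filter A P"
  shows "lattice_filter A {x \<in> carrier A. \<box>x \<in> P}"
  unfolding lattice_filter_def
proof (intro conjI ballI impI)
  show "\<top> \<in> {x \<in> carrier A. \<box>x \<in> P}"
    using filter_top[OF prime_filter_filter[OF P]] box_top by simp
  show "y \<in> {x \<in> carrier A. \<box>x \<in> P}"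
    if "x \<in> {x \<in> carrier A. \<box>x \<in> P}" "y \<in> carrier A" "x \<sqsubseteq> y" for x y
    using filter_up[OF prime_filter_filter[OF P] _ box_mono[OF that(3)]] that box_closed by simp
qed (simp_all add: box_meet box_closed prime_filter_meet_iff[OF P])

lemma dia_preimage_ideal:
  assumes P: "prime_filter A P"
  shows "lattice_ideal A {x \<in> carrier A. \<diamond>x \<notin> P}"
  unfolding lattice_ideal_def
proof (intro conjI ballI impI)
  show "\<bottom> \<in> {x \<in> carrier A. \<diamond>x \<notin> P}"
    using prime_filter_bottom[OF P] dia_bottom by simp
  show "y \<in> {x \<in> carrier A. \<diamond>x \<notin> P}"
    if "x \<in> {x \<in> carrier A. \<diamond>x \<notin> P}" "y \<in> carrier A" "y \<sqsubseteq> x" for x y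
    using filter_up[OF prime_filter_filter[OF P] _ dia_mono[OF that(3)]] that dia_closed by blast
qed (simp_all add: dia_join dia_closed prime_filter_join_iff[OF P])

lemma canonical_relI:
  assumes "Q \<subseteq> carrier A" "{x \<in> carrier A. \<box>x \<in> P} \<subseteq> Q" "Q \<inter> {x \<in> carrier A. \<diamond>x \<notin> P} = {}"
  shows "canonical_rel P Q"
  using assms unfolding canonical_rel_def by blast

text \<open>
  The successor \<open>Q\<close> has to contain the filter of all \<open>x\<close> with \<open>\<box>x \<in> P\<close> and to avoid \<open>a\<close> as well as
  the ideal of all \<open>m\<close> with \<open>\<diamond>m \<notin> P\<close>. If the filter met the ideal generated by the latter two, some
  \<open>\<box>(a \<squnion> m)\<close> would be in \<open>P\<close>; as \<open>\<box>(a \<squnion> m) \<sqsubseteq> \<box>a \<squnion> \<diamond>m\<close> and \<open>P\<close> is prime, \<open>\<box>a\<close> or \<open>\<diamond>m\<close>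
  would be in \<open>P\<close>.
\<close>

lemma box_witness:
  assumes P: "prime_filter A P" and a: "a \<in> carrier A" "\<box>a \<notin> P"
  obtains Q where "prime_filter A Q" "canonical_rel P Q" "a \<notin> Q"
proof -
  let ?F = "{x \<in> carrier A. \<box>x \<in> P}" and ?I = "{x \<in> carrier A. \<diamond>x \<notin> P}"
  let ?J = "{z \<in> carrier A. \<exists>m\<in>?I. z \<sqsubseteq> a \<squnion> m}"
  note I = dia_preimage_ideal[OF P]
  have "?F \<inter> ?J = {}"
  proof (rule ccontr)
    assume "?F \<inter> ?J \<noteq> {}"
    then obtain z m where z: "z \<in> carrier A" "\<box>z \<in> P" "z \<sqsubseteq> a \<squnion> m"
      and m: "m \<in> carrier A" "\<diamond>m \<notin> P" by blast
    have "\<box>z \<sqsubseteq> \<box>(a \<squnion> m)" "\<box>(a \<squnion> m) \<sqsubseteq> \<box>a \<squnion> \<diamond>m"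
      using box_mono box_join_le z m a by simp_all
    then have "\<box>z \<sqsubseteq> \<box>a \<squnion> \<diamond>m"
      using z m a box_closed dia_closed by (meson le_trans join_closed)
    then have "\<box>a \<squnion> \<diamond>m \<in> P"
      using filter_up[OF prime_filter_filter[OF P] z(2)] m a box_closed dia_closed by simp
    then show False
      using prime_filter_join[OF P] m a box_closed dia_closed by blast
  qed
  then obtain Q where Q: "prime_filter A Q" "?F \<subseteq> Q" "Q \<inter> ?J = {}"
    by (rule prime_filter_separation[OF box_preimage_filter[OF P] ideal_adjoin[OF I a(1)]])
  have "canonical_rel P Q"
    using Q subset_ideal_adjoin[OF I a(1)] filter_subset[OF prime_filter_filter[OF Q(1)]]
    by (intro canonical_relI) blast+
  moreover have "a \<notin> Q"
    using Q(3) mem_ideal_adjoin[OF I a(1)] by blast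
  ultimately show thesis using that Q(1) by blast
qed

text \<open>
  The order dual of the preceding argument: \<open>a\<close> is now adjoined to the filter, and the conflict
  comes from \<open>\<box>m \<sqinter> \<diamond>a \<sqsubseteq> \<diamond>(m \<sqinter> a)\<close>.
\<close>

lemma dia_witness:
  assumes P: "prime_filter A P" and a: "a \<in> carrier A" "\<diamond>a \<in> P"
  obtains Q where "prime_filter A Q" "canonical_rel P Q" "a \<in> Q"
proof -
  let ?F = "{x \<in> carrier A. \<box>x \<in> P}" and ?I = "{x \<in> carrier A. \<diamond>x \<notin> P}"
  let ?G = "{z \<in> carrier A. \<exists>m\<in>?F. m \<sqinter> a \<sqsubseteq> z}"
  note F = box_preimage_filter[OF P]
  have "?G \<inter> ?I = {}"
  proof (rule ccontr)
    assume "?G \<inter> ?I \<noteq> {}"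
    then obtain z m where z: "z \<in> carrier A" "\<diamond>z \<notin> P" "m \<sqinter> a \<sqsubseteq> z"
      and m: "m \<in> carrier A" "\<box>m \<in> P" by blast
    have "\<box>m \<sqinter> \<diamond>a \<sqsubseteq> \<diamond>(m \<sqinter> a)" "\<diamond>(m \<sqinter> a) \<sqsubseteq> \<diamond>z"
      using dia_mono meet_dia_le z m a by simp_all
    then have "\<box>m \<sqinter> \<diamond>a \<sqsubseteq> \<diamond>z"
      using z m a box_closed dia_closed by (meson le_trans meet_closed)
    moreover have "\<box>m \<sqinter> \<diamond>a \<in> P"
      using filter_meet[OF prime_filter_filter[OF P]] m a by blast
    ultimately show False
      using filter_up[OF prime_filter_filter[OF P]] z dia_closed by blast
  qed
  then obtain Q where Q: "prime_filter A Q" "?G \<subseteq> Q" "Q \<inter> ?I = {}"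
    by (rule prime_filter_separation[OF filter_adjoin[OF F a(1)] dia_preimage_ideal[OF P]])
  have "canonical_rel P Q"
    using Q subset_filter_adjoin[OF F a(1)] filter_subset[OF prime_filter_filter[OF Q(1)]]
    by (intro canonical_relI) blast+
  moreover have "a \<in> Q"
    using Q(2) mem_filter_adjoin[OF F a(1)] by blast
  ultimately show thesis using that Q(1) by blast
qed

definition worlds :: "'a set set" where
  "worlds = {P. prime_filter A P \<and> (\<exists>n. (box A ^^ n) \<bottom> \<in> P)}"

definition access :: "('a set \<times> 'a set) set" where
  "access = {(P, Q). P \<in> worlds \<and> Q \<in> worlds \<and> canonical_rel P Q}"

definition height :: "'a set \<Rightarrow> nat" where
  "height P = (LEAST n. (box A ^^ n) \<bottom> \<in> P)"

lemma box_iterate_closed: "(box A ^^ n) \<bottom> \<in> carrier A"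
  by (induction n) (simp_all add: box_closed)

text \<open>
  The height of a world is positive because \<open>\<bottom>\<close>, the iterate without any box, belongs to no
  prime filter, so one box can be stripped off when passing to a successor.
\<close>

lemma successor_height:
  assumes P: "P \<in> worlds" and Q: "prime_filter A Q" and PQ: "canonical_rel P Q"
  shows "Q \<in> worlds" and "height Q < height P"
proof -
  have P': "prime_filter A P" and ex: "\<exists>n. (box A ^^ n) \<bottom> \<in> P"
    using P by (auto simp: worlds_def)
  have mem: "(box A ^^ height P) \<bottom> \<in> P"
    unfolding height_def using ex by (rule LeastI_ex)
  then obtain n where n: "height P = Suc n"
    using prime_filter_bottom[OF P'] by (cases "height P") auto
  then have Qn: "(box A ^^ n) \<bottom> \<in> Q"
    using mem PQ box_iterate_closed unfolding canonical_rel_def by auto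
  then show "Q \<in> worlds" using Q by (auto simp: worlds_def)
  have "height Q \<le> n" unfolding height_def using Qn by (rule Least_le)
  then show "height Q < height P" using n by simp
qed

lemma access_subset: "access \<subseteq> worlds \<times> worlds"
  by (auto simp: access_def)

lemma trans_access: "trans access"
proof (rule transI)
  fix P Q S assume "(P, Q) \<in> access" "(Q, S) \<in> access"
  then show "(P, S) \<in> access"
    using canonical_rel_trans[of P Q S] by (simp add: access_def worlds_def)
qed

lemma wf_access_converse: "wf (access\<inverse>)"
proof (rule wf_subset)
  show "access\<inverse> \<subseteq> measure height"
  proof
    fix z assume "z \<in> access\<inverse>"
    then have "(snd z, fst z) \<in> access" by (cases z) simp
    then have "height (fst z) < height (snd z)"
      by (intro successor_height(2)) (simp_all add: access_def worlds_def)
    then show "z \<in> measure height" by (cases z) simp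
  qed
qed simp

definition stone_map :: "'a \<Rightarrow> 'a set set" where
  "stone_map a = {P \<in> worlds. a \<in> P}"

text \<open>
  The witnesses for both modalities are successors of a world, hence worlds themselves.
\<close>

lemma stone_map_box:
  assumes "a \<in> carrier A"
  shows "stone_map (\<box>a) = {P \<in> worlds. access `` {P} \<subseteq> stone_map a}"
proof (intro equalityI subsetI)
  fix P assume "P \<in> stone_map (\<box>a)"
  then show "P \<in> {P \<in> worlds. access `` {P} \<subseteq> stone_map a}"
    using assms by (auto simp: stone_map_def access_def canonical_rel_def)
next
  fix P assume P: "P \<in> {P \<in> worlds. access `` {P} \<subseteq> stone_map a}"
  show "P \<in> stone_map (\<box>a)"
  proof (rule ccontr)
    assume "P \<notin> stone_map (\<box>a)"
    with P have "prime_filter A P" "\<box>a \<notin> P"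
      by (auto simp: stone_map_def worlds_def)
    then obtain Q where "prime_filter A Q" "canonical_rel P Q" "a \<notin> Q"
      using box_witness assms by blast
    with P successor_height(1) show False
      by (auto simp: access_def stone_map_def)
  qed
qed

lemma stone_map_dia:
  assumes "a \<in> carrier A"
  shows "stone_map (\<diamond>a) = {P \<in> worlds. access `` {P} \<inter> stone_map a \<noteq> {}}"
proof (intro equalityI subsetI)
  fix P assume P: "P \<in> stone_map (\<diamond>a)"
  then have "P \<in> worlds" "prime_filter A P" "\<diamond>a \<in> P"
    by (auto simp: stone_map_def worlds_def)
  moreover from this obtain Q where "prime_filter A Q" "canonical_rel P Q" "a \<in> Q"
    using dia_witness assms by blast
  ultimately show "P \<in> {P \<in> worlds. access `` {P} \<inter> stone_map a \<noteq> {}}"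
    using successor_height(1) by (auto simp: access_def stone_map_def)
next
  fix P assume "P \<in> {P \<in> worlds. access `` {P} \<inter> stone_map a \<noteq> {}}"
  then show "P \<in> stone_map (\<diamond>a)"
    using assms by (auto simp: stone_map_def access_def canonical_rel_def)
qed

text \<open>
  It suffices to bound each \<open>a \<sqinter> \<box>\<^sup>n\<bottom>\<close> by \<open>b\<close>, since \<open>a\<close> is their least upper bound; and a prime
  filter refuting that bound contains \<open>\<box>\<^sup>n\<bottom>\<close>, so it is a world.
\<close>

lemma stone_map_le_imp_le:
  assumes a: "a \<in> carrier A" and b: "b \<in> carrier A" and sub: "stone_map a \<subseteq> stone_map b"
  shows "a \<sqsubseteq> b"
proof -
  have "a \<sqinter> (box A ^^ n) \<bottom> \<sqsubseteq> b" for n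
  proof (rule ccontr)
    assume "\<not> a \<sqinter> (box A ^^ n) \<bottom> \<sqsubseteq> b"
    then obtain P where P: "prime_filter A P" "a \<sqinter> (box A ^^ n) \<bottom> \<in> P" "b \<notin> P"
      using prime_filter_not_le a b box_iterate_closed by (metis meet_closed)
    then have "P \<in> stone_map a"
      using a box_iterate_closed by (auto simp: stone_map_def worlds_def prime_filter_meet_iff)
    with sub P(3) show False by (auto simp: stone_map_def)
  qed
  then have "b \<in> Upper A {a \<sqinter> (box A ^^ n) \<bottom> |n. True}"
    using b by (auto simp: Upper_def)
  then show ?thesis
    using least_le[OF box_iterates_lub[OF a]] by blast
qed

lemma modal_monomorphism_stone_map:
  "modal_monomorphism A (lattice_reduct (complex_algebra worlds access)) stone_map"
proof -
  interpret C: modal_distributive_lattice "lattice_reduct (complex_algebra worlds access)"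
    using access_subset by (rule modal_distributive_lattice_reduct)
  have sub: "stone_map x \<subseteq> worlds" for x by (auto simp: stone_map_def)
  have pf: "prime_filter A P" if "P \<in> worlds" for P using that by (simp add: worlds_def)
  show ?thesis
  proof
    show "stone_map x \<in> carrier (lattice_reduct (complex_algebra worlds access))" for x
      using sub by simp
    show "stone_map \<bottom> = \<bottom>\<^bsub>lattice_reduct (complex_algebra worlds access)\<^esub>"
      using prime_filter_bottom pf by (auto simp: stone_map_def)
    show "stone_map \<top> = \<top>\<^bsub>lattice_reduct (complex_algebra worlds access)\<^esub>"
      using filter_top[OF prime_filter_filter] pf by (auto simp: stone_map_def)
    show "inj_on stone_map (carrier A)"
      using stone_map_le_imp_le by (intro inj_onI le_antisym) auto
    fix x assume x: "x \<in> carrier A"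
    show "stone_map (\<box>x) = \<box>\<^bsub>lattice_reduct (complex_algebra worlds access)\<^esub>(stone_map x)"
      using stone_map_box[OF x] by simp
    show "stone_map (\<diamond>x) = \<diamond>\<^bsub>lattice_reduct (complex_algebra worlds access)\<^esub>(stone_map x)"
      using stone_map_dia[OF x] by (simp add: dia_reduct[OF access_subset])
    fix y assume y: "y \<in> carrier A"
    show "stone_map (x \<squnion> y) = stone_map x \<squnion>\<^bsub>lattice_reduct (complex_algebra worlds access)\<^esub> stone_map y"
      using prime_filter_join_iff[OF pf x y] by (auto simp: sub) (auto simp: stone_map_def)
    show "stone_map (x \<sqinter> y) = stone_map x \<sqinter>\<^bsub>lattice_reduct (complex_algebra worlds access)\<^esub> stone_map y"
      using prime_filter_meet_iff[OF pf x y] by (auto simp: sub) (auto simp: stone_map_def)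
  qed
qed

end

theorem corollary3p5:
  fixes A :: "('a, 'm) modal_dlat_scheme"
  assumes "gld_lattice A"
  shows "\<exists>(B :: 'a set set modal_balg) (\<eta> :: 'a \<Rightarrow> 'a set set).
    gl_algebra B \<and> modal_monomorphism A (lattice_reduct B) \<eta>"
proof -
  interpret gld_lattice A by (rule assms)
  show ?thesis
    using gl_algebra_complex_algebra[OF access_subset trans_access wf_access_converse]
      modal_monomorphism_stone_map by blast
qed

end
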